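(* Let $\mathcal X$ be an RD-space, let $\rho$ be an admissible function on $\mathcal X$, and let $\mathcal D$ be the collection of balls $B(x,r)$ with $r\ge\rho(x)$. There exists a positive constant $C$ such that for all $f\in\mathrm{BLO}_\rho(\mathcal X)$, $f(x)\ge -C\|f\|_{\mathrm{BLO}_\rho(\mathcal X)}$ for almost all $x\in\mathcal X$. Moreover, the following statements are equivalent: (i) $f\in\mathrm{BLO}_\rho(\mathcal X)$; (ii) $f\in L^1_{\rm loc}(\mathcal X)$ and there exists a nonnegative constant $A$ such that $$\sup_{B\notin\mathcal D}\left\{\frac1{\mu(B)}\int_B\left[f(y)-\operatorname*{ess\,inf}_B f\right]d\mu(y)\right\}+\sup_{B\in\mathcal D}\left\{\frac1{\mu(B)}\int_B|f(y)|\,d\mu(y)+\left|\operatorname*{ess\,inf}_B f\right|\right\}\le A;$$ (iii) $f\in L^1_{\rm loc}(\mathcal X)$ and there exists a nonnegative constant $\widetilde C$ such that $$\sup_{B\subset\mathcal X}\left\{\frac1{\mu(B)}\int_B\left[f(y)-\operatorname*{ess\,inf}_B f\right]d\mu(y)\right\}+\sup_{B\in\mathcal D}\left\{\frac1{\mu(B)}\int_B|f(y)|\,d\mu(y)\right\}\le\widetilde C.$$ Moreover, $\|f\|_{\mathrm{BLO}_\rho(\mathcal X)}$, $\inf\{A\}$ and $\inf\{\widetilde C\}$ (infima over all constants $A$, respectively $\widetilde C$, for which (ii), respectively (iii), holds) are mutually equivalent, i.e. each is bounded by a constant independent of $f$ times any other.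
   Context: RD-space: $(\mathcal X,d)$ is a metric space with a regular Borel measure $\mu$ such that all balls $B(x,r)=\{y: d(x,y)<r\}$ have finite and positive measure; $\mu$ is doubling, i.e. there is $A_1\ge1$ with $\mu(B(x,2r))\le A_1\mu(B(x,r))$ for all $x\in\mathcal X$, $r>0$; and there are $0<\kappa\le n$, $A_2\in(0,1]$, $A_3\in[1,\infty)$ such that $A_2\lambda^\kappa\mu(B(x,r))\le\mu(B(x,\lambda r))\le A_3\lambda^n\mu(B(x,r))$ for all $x\in\mathcal X$, $0<r\le \mathrm{diam}(\mathcal X)/2$ and $1\le\lambda\le \mathrm{diam}(\mathcal X)/(2r)$. Balls are understood together with their center and radius. Admissible function: $\rho:\mathcal X\to(0,\infty)$ is admissible if there are positive constants $C_0,k_0$ such that $\frac1{\rho(x)}\le C_0\frac1{\rho(y)}\left(1+\frac{d(x,y)}{\rho(y)}\right)^{k_0}$ for all $x,y\in\mathcal X$. Functions here are real-valued; $L^1_{\rm loc}(\mathcal X)$ means integrable on every ball. A function $f\in L^1_{\rm loc}(\mathcal X)$ is in $\mathrm{BLO}_\rho(\mathcal X)$ if $$\|f\|_{\mathrm{BLO}_\rho(\mathcal X)}=\sup_{B\notin\mathcal D}\frac1{\mu(B)}\int_B\left[f(y)-\operatorname*{ess\,inf}_B f\right]d\mu(y)+\sup_{B\in\mathcal D}\frac1{\mu(B)}\int_B|f(y)|\,d\mu(y)<\infty,$$ where $B(x,r)\notin\mathcal D$ means $r<\rho(x)$. *)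

theory Defs
  imports "HOL-Analysis.Analysis" "HOL-Probability.Essential_Supremum"
begin

(* The measure may be defined on more than the Borel sets (for instance it may be complete, or the
   restriction of a Borel regular outer measure to its measurable sets); regularity is outer
   regularity. *)
definition regular_borel_measure :: "'a::metric_space measure \<Rightarrow> bool" where
  "regular_borel_measure M \<longleftrightarrow>
     sets borel \<subseteq> sets M \<and>
     (\<forall>A\<in>sets M. emeasure M A = (INF U\<in>{U. open U \<and> A \<subseteq> U}. emeasure M U))"

(* The library constant "diameter" is a real number and is meaningless for unbounded sets. *)
definition space_diam :: "'a::metric_space itself \<Rightarrow> ereal" where
  "space_diam _ = (SUP (x, y) \<in> (UNIV :: ('a \<times> 'a) set). ereal (dist x y))"

definition rd_space :: "'a::metric_space measure \<Rightarrow> bool" where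
  "rd_space M \<longleftrightarrow>
     regular_borel_measure M \<and>
     (\<forall>x r. 0 < r \<longrightarrow> 0 < emeasure M (ball x r) \<and> emeasure M (ball x r) < \<infinity>) \<and>
     (\<exists>A1\<ge>1. \<forall>x r. 0 < r \<longrightarrow> measure M (ball x (2 * r)) \<le> A1 * measure M (ball x r)) \<and>
     (\<exists>\<kappa> n A2 A3. 0 < \<kappa> \<and> \<kappa> \<le> n \<and> 0 < A2 \<and> A2 \<le> 1 \<and> 1 \<le> A3 \<and>
        (\<forall>x r l. 0 < r \<longrightarrow> ereal r \<le> space_diam TYPE('a) / 2 \<longrightarrow>
           1 \<le> l \<longrightarrow> ereal l \<le> space_diam TYPE('a) / ereal (2 * r) \<longrightarrow>
             A2 * l powr \<kappa> * measure M (ball x r) \<le> measure M (ball x (l * r)) \<and>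
             measure M (ball x (l * r)) \<le> A3 * l powr n * measure M (ball x r)))"

definition admissible :: "('a::metric_space \<Rightarrow> real) \<Rightarrow> bool" where
  "admissible \<rho> \<longleftrightarrow>
     (\<forall>x. 0 < \<rho> x) \<and>
     (\<exists>C0>0. \<exists>k0>0. \<forall>x y. 1 / \<rho> x \<le> C0 * (1 / \<rho> y) * (1 + dist x y / \<rho> y) powr k0)"

(* A ball is a pair (center, radius), since membership in large_balls depends on both and not only on
   the underlying set. *)
definition balls :: "('a::metric_space \<times> real) set" where
  "balls = {(x, r). 0 < r}"

definition large_balls :: "('a::metric_space \<Rightarrow> real) \<Rightarrow> ('a \<times> real) set" where
  "large_balls \<rho> = {(x, r) \<in> balls. \<rho> x \<le> r}"

definition L1_loc :: "'a::metric_space measure \<Rightarrow> ('a \<Rightarrow> real) set" where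
  "L1_loc M = {f. \<forall>(x, r)\<in>balls. set_integrable M (ball x r) f}"

definition ess_inf_on :: "'a measure \<Rightarrow> 'a set \<Rightarrow> ('a \<Rightarrow> real) \<Rightarrow> ereal" where
  "ess_inf_on M B f = - esssup (restrict_space M B) (\<lambda>y. - ereal (f y))"

(* The integrand is nonnegative almost everywhere on B and is infinite when the essential
   infimum is -\<infinity>, so the mean is an extended nonnegative number. *)
definition mean_osc :: "'a measure \<Rightarrow> 'a set \<Rightarrow> ('a \<Rightarrow> real) \<Rightarrow> ennreal" where
  "mean_osc M B f =
     (\<integral>\<^sup>+y\<in>B. e2ennreal (ereal (f y) - ess_inf_on M B f) \<partial>M) / emeasure M B"

definition mean_abs :: "'a measure \<Rightarrow> 'a set \<Rightarrow> ('a \<Rightarrow> real) \<Rightarrow> ennreal" where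
  "mean_abs M B f = (\<integral>\<^sup>+y\<in>B. ennreal \<bar>f y\<bar> \<partial>M) / emeasure M B"

definition BLO_norm :: "'a::metric_space measure \<Rightarrow> ('a \<Rightarrow> real) \<Rightarrow> ('a \<Rightarrow> real) \<Rightarrow> ennreal" where
  "BLO_norm M \<rho> f =
     (SUP (x, r)\<in>balls - large_balls \<rho>. mean_osc M (ball x r) f) +
     (SUP (x, r)\<in>large_balls \<rho>. mean_abs M (ball x r) f)"

definition BLO :: "'a::metric_space measure \<Rightarrow> ('a \<Rightarrow> real) \<Rightarrow> ('a \<Rightarrow> real) set" where
  "BLO M \<rho> = {f \<in> L1_loc M. BLO_norm M \<rho> f < \<infinity>}"

definition BLO_bounds_ii :: "'a::metric_space measure \<Rightarrow> ('a \<Rightarrow> real) \<Rightarrow> ('a \<Rightarrow> real) \<Rightarrow> real set" where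
  "BLO_bounds_ii M \<rho> f = {A. 0 \<le> A \<and>
     (SUP (x, r)\<in>balls - large_balls \<rho>. mean_osc M (ball x r) f) +
     (SUP (x, r)\<in>large_balls \<rho>.
        mean_abs M (ball x r) f + e2ennreal \<bar>ess_inf_on M (ball x r) f\<bar>) \<le> ennreal A}"

definition BLO_bounds_iii :: "'a::metric_space measure \<Rightarrow> ('a \<Rightarrow> real) \<Rightarrow> ('a \<Rightarrow> real) \<Rightarrow> real set" where
  "BLO_bounds_iii M \<rho> f = {C. 0 \<le> C \<and>
     (SUP (x, r)\<in>balls. mean_osc M (ball x r) f) +
     (SUP (x, r)\<in>large_balls \<rho>. mean_abs M (ball x r) f) \<le> ennreal C}"

end

theory Submission
  imports Defs
begin

text \<open>
  Write \<open>N\<close> for the norm of \<open>f\<close> and \<open>m\<^sub>B\<close> for the essential infimum of \<open>f\<close> on a ball \<open>B\<close>. Everything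
  rests on three inequalities between \<open>m\<^sub>B\<close>, the mean oscillation and the mean of \<open>\<bar>f\<bar>\<close> on the same
  ball, each obtained by averaging a pointwise triangle inequality:
  \<open>- m\<^sub>B \<le> osc\<^sub>B f + mean\<^sub>B \<bar>f\<bar>\<close>, \<open>m\<^sub>B \<le> mean\<^sub>B \<bar>f\<bar>\<close> and \<open>osc\<^sub>B f \<le> mean\<^sub>B \<bar>f\<bar> + \<bar>m\<^sub>B\<bar>\<close>.
  They are stated for extended nonnegative numbers, so that they also cover an infinite \<open>m\<^sub>B\<close>.

  The lower bound on \<open>f\<close> comes from the balls \<open>B = B(x, \<rho> x / 2)\<close>. Such a ball is small, so \<open>osc\<^sub>B f \<le> N\<close>,
  while its double is large, so by doubling \<open>mean\<^sub>B \<bar>f\<bar> \<le> A1 N\<close>; the first inequality then gives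
  \<open>f \<ge> m\<^sub>B \<ge> - (1 + A1) N\<close> almost everywhere on \<open>B\<close>. To pass from each ball to the whole space,
  the exceptional null sets must be countably many. This holds because an admissible function is bounded below
  near every point and because in a space whose balls have positive finite measure every uniformly
  separated set is countable: maximal \<open>1/n\<close>-separated sets, for all \<open>n\<close> together, supply enough centres
  (\<open>countable_cover_by_half_critical_balls\<close>).

  The global lower bound and the second inequality bound \<open>\<bar>m\<^sub>B\<bar>\<close> by \<open>(1 + A1) N\<close> on large balls, so
  \<open>(2 + A1) N\<close> belongs to \<open>BLO_bounds_ii\<close>. The third inequality turns a bound \<open>A\<close> of that set into the
  bound \<open>2 A\<close> in \<open>BLO_bounds_iii\<close>. Conversely any member of either set dominates \<open>N\<close>, because the
  quantity bounded there is at least \<open>N\<close>. Hence both infima lie between \<open>N\<close> and \<open>2 (2 + A1) N\<close>, and the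
  equivalences and comparabilities follow.
\<close>

section \<open>Essential infima and means\<close>

lemma ess_inf_on_le_AE:
  assumes "B \<in> sets M" "f \<in> borel_measurable M"
  shows "AE y in M. y \<in> B \<longrightarrow> ess_inf_on M B f \<le> ereal (f y)"
proof -
  have "AE y in restrict_space M B. - ereal (f y) \<le> esssup (restrict_space M B) (\<lambda>y. - ereal (f y))"
    by (rule esssup_AE)
  then have "AE y in M. y \<in> B \<longrightarrow> - ereal (f y) \<le> esssup (restrict_space M B) (\<lambda>y. - ereal (f y))"
    using assms by (subst (asm) AE_restrict_space_iff) auto
  then show ?thesis
    unfolding ess_inf_on_def by eventually_elim (auto simp: ereal_uminus_le_reorder)
qed

lemma ess_inf_on_greatest:
  assumes "B \<in> sets M" "f \<in> borel_measurable M"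
    and "AE y in M. y \<in> B \<longrightarrow> c \<le> ereal (f y)"
  shows "c \<le> ess_inf_on M B f"
proof -
  have "AE y in M. y \<in> B \<longrightarrow> - ereal (f y) \<le> - c"
    using assms(3) by eventually_elim (simp add: ereal_uminus_le_reorder flip: uminus_ereal.simps)
  then have "AE y in restrict_space M B. - ereal (f y) \<le> - c"
    using assms(1) by (subst AE_restrict_space_iff) auto
  then have "esssup (restrict_space M B) (\<lambda>y. - ereal (f y)) \<le> - c"
    using assms(2) by (intro esssup_I measurable_restrict_space1) auto
  then show ?thesis
    unfolding ess_inf_on_def using ereal_minus_le_minus by fastforce
qed

definition mean :: "'a measure \<Rightarrow> 'a set \<Rightarrow> ('a \<Rightarrow> ennreal) \<Rightarrow> ennreal" where
  "mean M B g = (\<integral>\<^sup>+y\<in>B. g y \<partial>M) / emeasure M B"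

lemma mean_osc_eq_mean: "mean_osc M B f = mean M B (\<lambda>y. e2ennreal (ereal (f y) - ess_inf_on M B f))"
  and mean_abs_eq_mean: "mean_abs M B f = mean M B (\<lambda>y. ennreal \<bar>f y\<bar>)"
  by (simp_all add: mean_osc_def mean_abs_def mean_def)

lemma mean_const:
  assumes "B \<in> sets M" "0 < emeasure M B" "emeasure M B < \<infinity>"
  shows "mean M B (\<lambda>_. c) = c"
  using assms by (simp add: mean_def nn_integral_cmult_indicator ennreal_times_divide[symmetric])

lemma mean_mono_AE:
  assumes "AE y in M. y \<in> B \<longrightarrow> g y \<le> h y"
  shows "mean M B g \<le> mean M B h"
  unfolding mean_def
proof (intro divide_right_mono_ennreal nn_integral_mono_AE)
  show "AE y in M. g y * indicator B y \<le> h y * indicator B y"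
    using assms by eventually_elim (auto simp: indicator_def)
qed

lemma mean_add:
  assumes "B \<in> sets M" "g \<in> borel_measurable M" "h \<in> borel_measurable M"
  shows "mean M B (\<lambda>y. g y + h y) = mean M B g + mean M B h"
  using assms
  by (simp add: mean_def distrib_right nn_integral_add divide_ennreal_def)

text \<open>Average \<open>- m \<le> (f y - m) + \<bar>f y\<bar>\<close>. If \<open>m = -\<infinity>\<close> both sides are infinite, so a finite
  mean oscillation and a finite mean force \<open>m\<close> to be bounded below.\<close>

lemma uminus_ess_inf_le_means:
  assumes B: "B \<in> sets M" "0 < emeasure M B" "emeasure M B < \<infinity>"
    and f [measurable]: "f \<in> borel_measurable M"
  shows "e2ennreal (- ess_inf_on M B f) \<le> mean_osc M B f + mean_abs M B f"
proof -
  let ?m = "ess_inf_on M B f"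
  have pt: "e2ennreal (- ?m) \<le> e2ennreal (ereal (f y) - ?m) + ennreal \<bar>f y\<bar>" for y
  proof (cases ?m)
    case (real r)
    \<comment> \<open>The conversion to extended nonnegative numbers replaces \<open>f y - r\<close> by its positive part.\<close>
    have "ennreal (- r) \<le> ennreal (max 0 (f y - r) + \<bar>f y\<bar>)"
      by (intro ennreal_leI) auto
    also have "\<dots> = ennreal (f y - r) + ennreal \<bar>f y\<bar>"
      by (simp add: max_def ennreal_neg)
    finally show ?thesis
      using real by simp
  qed auto
  have "e2ennreal (- ?m) = mean M B (\<lambda>_. e2ennreal (- ?m))"
    using mean_const[OF B] by simp
  also have "\<dots> \<le> mean M B (\<lambda>y. e2ennreal (ereal (f y) - ?m) + ennreal \<bar>f y\<bar>)"
    by (intro mean_mono_AE AE_I2 impI pt)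
  also have "\<dots> = mean_osc M B f + mean_abs M B f"
    unfolding mean_osc_eq_mean mean_abs_eq_mean by (intro mean_add B(1)) measurable
  finally show ?thesis .
qed

lemma mean_osc_le_mean_abs_plus:
  assumes B: "B \<in> sets M" "0 < emeasure M B" "emeasure M B < \<infinity>"
    and f [measurable]: "f \<in> borel_measurable M"
  shows "mean_osc M B f \<le> mean_abs M B f + e2ennreal \<bar>ess_inf_on M B f\<bar>"
proof -
  let ?m = "ess_inf_on M B f"
  have pt: "e2ennreal (ereal (f y) - ?m) \<le> ennreal \<bar>f y\<bar> + e2ennreal \<bar>?m\<bar>" for y
  proof (cases ?m)
    case (real r)
    have "ennreal (f y - r) \<le> ennreal (\<bar>f y\<bar> + \<bar>r\<bar>)"
      by (intro ennreal_leI) auto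
    then show ?thesis
      using real by (simp add: ennreal_plus e2ennreal_ereal)
  qed auto
  have "mean_osc M B f \<le> mean M B (\<lambda>y. ennreal \<bar>f y\<bar> + e2ennreal \<bar>?m\<bar>)"
    unfolding mean_osc_eq_mean by (intro mean_mono_AE AE_I2 impI pt)
  also have "\<dots> = mean_abs M B f + mean M B (\<lambda>_. e2ennreal \<bar>?m\<bar>)"
    unfolding mean_abs_eq_mean by (intro mean_add B(1)) measurable
  finally show ?thesis
    using mean_const[OF B] by simp
qed

lemma ess_inf_le_mean_abs:
  assumes B: "B \<in> sets M" "0 < emeasure M B" "emeasure M B < \<infinity>"
    and f [measurable]: "f \<in> borel_measurable M"
  shows "e2ennreal (ess_inf_on M B f) \<le> mean_abs M B f"
proof -
  let ?m = "ess_inf_on M B f"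
  have "AE y in M. y \<in> B \<longrightarrow> e2ennreal ?m \<le> ennreal \<bar>f y\<bar>"
    using ess_inf_on_le_AE[OF B(1) f]
  proof (eventually_elim, intro impI)
    fix y assume "y \<in> B \<longrightarrow> ?m \<le> ereal (f y)" "y \<in> B"
    then have "?m \<le> ereal \<bar>f y\<bar>"
      by (auto intro: order_trans)
    then show "e2ennreal ?m \<le> ennreal \<bar>f y\<bar>"
      using e2ennreal_mono by (fastforce simp: e2ennreal_ereal)
  qed
  then have "mean M B (\<lambda>_. e2ennreal ?m) \<le> mean_abs M B f"
    unfolding mean_abs_eq_mean by (rule mean_mono_AE)
  then show ?thesis
    using mean_const[OF B] by simp
qed

lemma mean_abs_le_mean_abs_superset:
  assumes B: "B \<subseteq> B'" "0 < emeasure M B" "emeasure M B' < \<infinity>" "B' \<in> sets M"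
    and a: "measure M B' \<le> a * measure M B"
  shows "mean_abs M B f \<le> ennreal a * mean_abs M B' f"
proof -
  let ?I = "\<lambda>B. \<integral>\<^sup>+y\<in>B. ennreal \<bar>f y\<bar> \<partial>M" and ?b = "measure M B" and ?b' = "measure M B'"
  have le: "emeasure M B \<le> emeasure M B'"
    using B by (intro emeasure_mono)
  have b: "emeasure M B = ennreal ?b" "emeasure M B' = ennreal ?b'"
    using le B(3) by (auto intro!: emeasure_eq_ennreal_measure)
  have pos: "0 < ?b" "0 < ?b'"
    using B(2) le b by (metis ennreal_less_zero_iff order_less_le_trans)+
  then have a0: "0 \<le> a"
    using a by (smt (verit) mult_neg_pos)
  have "mean_abs M B f = ?I B * ennreal (1 / ?b)"
    using pos by (simp add: mean_abs_def b divide_ennreal_def inverse_ennreal inverse_eq_divide)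
  also have "\<dots> \<le> ?I B' * ennreal (a * (1 / ?b'))"
    using B(1) a pos
    by (intro mult_mono nn_integral_mono ennreal_leI) (auto simp: field_simps indicator_def)
  also have "\<dots> = ennreal a * (?I B' * ennreal (1 / ?b'))"
    using a0 pos by (subst ennreal_mult) (auto simp: mult_ac)
  also have "\<dots> = ennreal a * mean_abs M B' f"
    using pos by (simp add: mean_abs_def b divide_ennreal_def inverse_ennreal inverse_eq_divide)
  finally show ?thesis .
qed

section \<open>Covering by balls of half the critical radius\<close>

lemma admissible_locally_bounded_below:
  assumes "admissible \<rho>"
  shows "\<exists>c>0. \<forall>y\<in>ball x 1. c \<le> \<rho> y"
proof -
  obtain C0 k0 where C: "C0 > 0" "k0 > 0"
    and adm: "\<And>x y. 1 / \<rho> x \<le> C0 * (1 / \<rho> y) * (1 + dist x y / \<rho> y) powr k0"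
    and pos: "\<And>x. 0 < \<rho> x"
    using assms unfolding admissible_def by blast
  define K where "K = C0 * (1 / \<rho> x) * (1 + 1 / \<rho> x) powr k0"
  have K: "K > 0"
    using C pos[of x] add_pos_pos[of 1 "1 / \<rho> x"] by (simp add: K_def)
  have "1 / K \<le> \<rho> y" if "y \<in> ball x 1" for y
  proof -
    have "1 / \<rho> y \<le> C0 * (1 / \<rho> x) * (1 + dist y x / \<rho> x) powr k0"
      by (rule adm)
    also have "\<dots> \<le> K"
      unfolding K_def using that C pos[of x]
      by (intro mult_left_mono powr_mono2 add_left_mono divide_right_mono)
         (auto simp: dist_commute intro: less_imp_le)
    finally show ?thesis
      using K pos[of y] by (simp add: field_simps)
  qed
  then show ?thesis
    using K by (intro exI[of _ "1 / K"]) auto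
qed

text \<open>The balls of radius \<open>e/2\<close> around the points of \<open>S\<close> are disjoint. Only finitely many of those with
  centre in a fixed ball can have measure above a given positive bound, since they lie in one ball of
  finite measure.\<close>

lemma countable_separated_set:
  fixes M :: "'a::metric_space measure"
  assumes sets: "\<And>x r. ball x r \<in> sets M"
    and meas: "\<And>x r. 0 < r \<Longrightarrow> 0 < emeasure M (ball x r) \<and> emeasure M (ball x r) < \<infinity>"
    and e: "0 < e" and sep: "\<And>s t :: 'a. s \<in> S \<Longrightarrow> t \<in> S \<Longrightarrow> s \<noteq> t \<Longrightarrow> e \<le> dist s t"
  shows "countable S"
proof -
  fix x0 :: 'a
  define P where "P n = {s \<in> S. dist x0 s < real n \<and> 1 / real (Suc n) < measure M (ball s (e/2))}" for n
  have fin: "finite (P n)" for n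
  proof (rule ccontr)
    let ?b = "measure M (ball x0 (real n + e))"
    assume "infinite (P n)"
    then obtain F where F: "F \<subseteq> P n" "finite F" "card F = nat \<lceil>?b * real (Suc n)\<rceil> + 1"
      by (meson infinite_arbitrarily_large)
    have bfin: "ball x0 (real n + e) \<in> fmeasurable M"
      using meas[of "real n + e" x0] e sets by (auto intro: fmeasurableI)
    have "disjoint_family_on (\<lambda>s. ball s (e/2)) F"
    proof (unfold disjoint_family_on_def, intro ballI impI)
      fix s t assume st: "s \<in> F" "t \<in> F" "s \<noteq> t"
      show "ball s (e/2) \<inter> ball t (e/2) = {}"
      proof (rule ccontr)
        assume "ball s (e/2) \<inter> ball t (e/2) \<noteq> {}"
        then obtain z where "dist s z < e/2" "dist t z < e/2" by auto
        then have "dist s t < e" by (metis dist_triangle_half_l dist_commute)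
        moreover have "s \<in> S" "t \<in> S" using st F(1) by (auto simp: P_def)
        ultimately show False using sep[of s t] st(3) by auto
      qed
    qed
    then have "(\<Sum>s\<in>F. measure M (ball s (e/2))) = measure M (\<Union>s\<in>F. ball s (e/2))"
      using F(2) sets meas e
      by (intro measure_finite_Union[symmetric]) (auto simp: less_top[symmetric] intro!: less_imp_neq)
    also have "\<dots> \<le> ?b"
    proof (rule measure_mono_fmeasurable)
      show "(\<Union>s\<in>F. ball s (e/2)) \<subseteq> ball x0 (real n + e)"
      proof
        fix z assume "z \<in> (\<Union>s\<in>F. ball s (e/2))"
        then obtain s where "s \<in> F" "dist s z < e/2" by auto
        moreover then have "dist x0 s < real n" using F(1) by (auto simp: P_def)
        ultimately show "z \<in> ball x0 (real n + e)"
          using dist_triangle[of x0 z s] e by auto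
      qed
    qed (use bfin sets F(2) in auto)
    finally have "(\<Sum>s\<in>F. measure M (ball s (e/2))) \<le> ?b" .
    moreover have "real (card F) * (1 / real (Suc n)) \<le> (\<Sum>s\<in>F. measure M (ball s (e/2)))"
      using F(1) by (intro sum_bounded_below) (auto simp: P_def)
    ultimately have "real (card F) * (1 / real (Suc n)) \<le> ?b"
      by linarith
    then have "real (card F) \<le> ?b * real (Suc n)"
      by (simp only: pos_divide_le_eq times_divide_eq_right mult_1_right of_nat_0_less_iff zero_less_Suc)
    moreover have "?b * real (Suc n) < real (card F)"
      using real_nat_ceiling_ge[of "?b * real (Suc n)"] by (simp only: F(3) of_nat_add of_nat_1)
    ultimately show False
      by simp
  qed
  have "S \<subseteq> (\<Union>n. P n)"
  proof
    fix s assume s: "s \<in> S"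
    let ?m = "measure M (ball s (e/2))"
    have "0 < ?m"
      using meas[of "e/2" s] e by (simp add: measure_def enn2real_positive_iff)
    then obtain n1 where n1: "1 / real (Suc n1) < ?m"
      using nat_approx_posE by metis
    obtain n2 where n2: "dist x0 s < real n2"
      using reals_Archimedean2 by blast
    have "1 / real (Suc (max n1 n2)) \<le> 1 / real (Suc n1)"
      by (intro divide_left_mono) auto
    then have "s \<in> P (max n1 n2)"
      using s n1 n2 by (auto simp: P_def)
    then show "s \<in> (\<Union>n. P n)" by blast
  qed
  moreover have "countable (\<Union>n. P n)"
    by (rule countable_UN) (auto intro: countable_finite fin)
  ultimately show ?thesis
    by (rule countable_subset)
qed

text \<open>A set that is maximal by Zorn's lemma is an \<open>e\<close>-net: a point at distance at least \<open>e\<close> from all of it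
  could be added.\<close>

lemma exists_maximal_separated_set:
  fixes e :: real
  assumes "0 < e"
  shows "\<exists>S :: 'a::metric_space set. (\<forall>s\<in>S. \<forall>t\<in>S. s \<noteq> t \<longrightarrow> e \<le> dist s t) \<and> (\<forall>x. \<exists>s\<in>S. dist x s < e)"
proof -
  let ?A = "{S :: 'a set. \<forall>s\<in>S. \<forall>t\<in>S. s \<noteq> t \<longrightarrow> e \<le> dist s t}"
  have "\<exists>S\<in>?A. \<forall>X\<in>?A. S \<subseteq> X \<longrightarrow> X = S"
  proof (rule subset_Zorn')
    fix C assume C: "subset.chain ?A C"
    show "\<Union>C \<in> ?A"
    proof (clarify)
      fix s t X Y assume st: "s \<in> X" "X \<in> C" "t \<in> Y" "Y \<in> C" "s \<noteq> t"
      then have "X \<subseteq> Y \<or> Y \<subseteq> X" "X \<in> ?A" "Y \<in> ?A"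
        using C unfolding subset.chain_def by blast+
      then show "e \<le> dist s t" using st by blast
    qed
  qed
  then obtain S where S: "S \<in> ?A" and max: "\<forall>X\<in>?A. S \<subseteq> X \<longrightarrow> X = S"
    by (rule bexE)
  have "\<exists>s\<in>S. dist x s < e" for x
  proof (rule ccontr)
    assume far: "\<not> (\<exists>s\<in>S. dist x s < e)"
    then have "insert x S \<in> ?A"
      using S by (auto simp: dist_commute not_less)
    then have "x \<in> S" using bspec[OF max, of "insert x S"] by blast
    then show False using far assms by force
  qed
  then show ?thesis using S by blast
qed

text \<open>The radius \<open>\<rho> s / 2\<close> varies with the centre and need not be bounded away from \<open>0\<close> on the whole space, so a
  single net does not suffice. Near \<open>x\<close> it is at least some \<open>c / 2\<close>, and a net of mesh below \<open>c / 2\<close> then has a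
  point whose ball contains \<open>x\<close>.\<close>

lemma countable_cover_by_half_critical_balls:
  fixes M :: "'a::metric_space measure"
  assumes sets: "\<And>x r. ball x r \<in> sets M"
    and meas: "\<And>x r. 0 < r \<Longrightarrow> 0 < emeasure M (ball x r) \<and> emeasure M (ball x r) < \<infinity>"
    and adm: "admissible (\<rho> :: 'a \<Rightarrow> real)"
  shows "\<exists>T. countable T \<and> (\<forall>x. \<exists>s\<in>T. x \<in> ball s (\<rho> s / 2))"
proof -
  have "\<forall>n. \<exists>S :: 'a set. (\<forall>s\<in>S. \<forall>t\<in>S. s \<noteq> t \<longrightarrow> 1 / real (Suc n) \<le> dist s t)
      \<and> (\<forall>x. \<exists>s\<in>S. dist x s < 1 / real (Suc n))"
    by (intro allI exists_maximal_separated_set) simp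
  then obtain S :: "nat \<Rightarrow> 'a set"
    where sep: "\<And>n s t. s \<in> S n \<Longrightarrow> t \<in> S n \<Longrightarrow> s \<noteq> t \<Longrightarrow> 1 / real (Suc n) \<le> dist s t"
      and net: "\<And>n x. \<exists>s\<in>S n. dist x s < 1 / real (Suc n)"
    by metis
  have "countable (S n)" for n
    by (rule countable_separated_set[OF sets meas, of "1 / real (Suc n)"]) (auto intro: sep[of _ n, simplified])
  then have "countable (\<Union>n. S n)" by blast
  moreover have "\<exists>s\<in>\<Union>n. S n. x \<in> ball s (\<rho> s / 2)" for x
  proof -
    obtain c where c: "c > 0" "\<And>y. y \<in> ball x 1 \<Longrightarrow> c \<le> \<rho> y"
      using admissible_locally_bounded_below[OF adm, of x] by blast
    obtain n where n: "1 / real (Suc n) < min 1 (c / 2)"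
      using nat_approx_posE[of "min 1 (c / 2)"] c(1) by auto
    obtain s where s: "s \<in> S n" "dist x s < 1 / real (Suc n)"
      using net by blast
    then have "dist x s < 1" "dist x s < c / 2"
      using n by linarith+
    moreover from this have "c \<le> \<rho> s"
      by (intro c(2)) auto
    ultimately have "x \<in> ball s (\<rho> s / 2)"
      by (simp add: dist_commute)
    then show ?thesis using s by blast
  qed
  ultimately show ?thesis by blast
qed

section \<open>Functions of bounded lower oscillation under a doubling measure\<close>

lemma L1_loc_measurable:
  fixes M :: "'a::metric_space measure"
  assumes "f \<in> L1_loc M"
  shows "f \<in> borel_measurable M"
proof -
  fix x0 :: 'a
  let ?g = "\<lambda>n x. indicator (ball x0 (real (Suc n))) x *\<^sub>R f x"
  have "?g n \<in> borel_measurable M" for n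
    using assms by (auto simp: L1_loc_def balls_def set_integrable_def simp del: real_scaleR_def
        intro!: borel_measurable_integrable)
  moreover have "(\<lambda>n. ?g n x) \<longlonglongrightarrow> f x" for x
  proof (rule tendsto_eventually)
    obtain N where N: "dist x0 x < real N" using reals_Archimedean2 by blast
    show "\<forall>\<^sub>F n in sequentially. ?g n x = f x"
      using eventually_ge_at_top[of N] by eventually_elim (use N in \<open>auto simp: indicator_def\<close>)
  qed
  ultimately show ?thesis
    by (intro borel_measurable_LIMSEQ_real[of M ?g f]) auto
qed


locale doubling_measure =
  fixes M :: "'a::metric_space measure" and A1 :: real
  assumes ball_sets: "ball x r \<in> sets M"
    and ball_measure: "0 < r \<Longrightarrow> 0 < emeasure M (ball x r) \<and> emeasure M (ball x r) < \<infinity>"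
    and doubling: "0 < r \<Longrightarrow> measure M (ball x (2 * r)) \<le> A1 * measure M (ball x r)"
    and A1_ge_1: "1 \<le> A1"
begin

lemma mean_osc_le_BLO_norm:
  "0 < r \<Longrightarrow> r < \<rho> x \<Longrightarrow> mean_osc M (ball x r) f \<le> BLO_norm M \<rho> f"
  unfolding BLO_norm_def
  by (rule add_increasing2[OF zero_le SUP_upper2[of "(x, r)"]]) (auto simp: balls_def large_balls_def)

lemma mean_abs_le_BLO_norm:
  "0 < r \<Longrightarrow> \<rho> x \<le> r \<Longrightarrow> mean_abs M (ball x r) f \<le> BLO_norm M \<rho> f"
  unfolding BLO_norm_def
  by (rule add_increasing[OF zero_le SUP_upper2[of "(x, r)"]]) (auto simp: balls_def large_balls_def)

text \<open>The ball of radius \<open>\<rho> x / 2\<close> is small and its double is large, so it sees both parts of the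
  norm.\<close>

lemma uminus_ess_inf_half_critical_ball_le:
  assumes \<rho>: "0 < \<rho> x" and f: "f \<in> borel_measurable M"
  shows "e2ennreal (- ess_inf_on M (ball x (\<rho> x / 2)) f) \<le> ennreal (1 + A1) * BLO_norm M \<rho> f"
proof -
  let ?B = "ball x (\<rho> x / 2)" and ?N = "BLO_norm M \<rho> f"
  have B: "?B \<in> sets M" "0 < emeasure M ?B" "emeasure M ?B < \<infinity>"
    using ball_sets ball_measure[of "\<rho> x / 2" x] \<rho> by auto
  have "e2ennreal (- ess_inf_on M ?B f) \<le> mean_osc M ?B f + mean_abs M ?B f"
    by (rule uminus_ess_inf_le_means[OF B f])
  also have "\<dots> \<le> ?N + ennreal A1 * mean_abs M (ball x (\<rho> x)) f"
  proof (intro add_mono)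
    show "mean_osc M ?B f \<le> ?N"
      using \<rho> by (intro mean_osc_le_BLO_norm) auto
    show "mean_abs M ?B f \<le> ennreal A1 * mean_abs M (ball x (\<rho> x)) f"
      using \<rho> B ball_sets ball_measure[of "\<rho> x" x] doubling[of "\<rho> x / 2" x]
      by (intro mean_abs_le_mean_abs_superset) auto
  qed
  also have "\<dots> \<le> ?N + ennreal A1 * ?N"
    using \<rho> by (intro add_left_mono mult_left_mono mean_abs_le_BLO_norm) auto
  also have "\<dots> = ennreal (1 + A1) * ?N"
    using A1_ge_1 by (simp add: distrib_right)
  finally show ?thesis .
qed

lemma BLO_AE_lower_bound:
  assumes adm: "admissible \<rho>" and f: "f \<in> BLO M \<rho>"
  shows "AE x in M. - (1 + A1) * enn2real (BLO_norm M \<rho> f) \<le> f x"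
proof -
  let ?N = "BLO_norm M \<rho> f"
  let ?K = "(1 + A1) * enn2real ?N"
  have K: "ennreal (1 + A1) * ?N = ennreal ?K"
    using f A1_ge_1 by (simp add: BLO_def ennreal_mult ennreal_enn2real)
  have fm: "f \<in> borel_measurable M"
    using f by (intro L1_loc_measurable) (simp add: BLO_def)
  obtain T where T: "countable T" "\<And>x. \<exists>s\<in>T. x \<in> ball s (\<rho> s / 2)"
    using countable_cover_by_half_critical_balls[OF ball_sets ball_measure adm] by blast
  have "AE y in M. y \<in> ball s (\<rho> s / 2) \<longrightarrow> - ?K \<le> f y" for s
  proof -
    let ?m = "ess_inf_on M (ball s (\<rho> s / 2)) f"
    have "e2ennreal (- ?m) \<le> ennreal ?K"
      using uminus_ess_inf_half_critical_ball_le[of \<rho> s f] adm fm K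
      by (simp add: admissible_def)
    moreover have "0 \<le> ?K"
      using A1_ge_1 by simp
    ultimately have m: "- ereal ?K \<le> ?m"
      by (cases ?m) (auto simp: ennreal_le_iff2 top_unique)
    show ?thesis
      using ess_inf_on_le_AE[OF ball_sets fm, of s "\<rho> s / 2"]
    proof (eventually_elim, intro impI)
      fix y assume "y \<in> ball s (\<rho> s / 2) \<longrightarrow> ?m \<le> ereal (f y)" "y \<in> ball s (\<rho> s / 2)"
      then have "- ereal ?K \<le> ereal (f y)"
        using m order_trans by blast
      then show "- ?K \<le> f y" by simp
    qed
  qed
  then have "AE y in M. \<forall>s\<in>T. y \<in> ball s (\<rho> s / 2) \<longrightarrow> - ?K \<le> f y"
    using T(1) by (subst AE_ball_countable) auto
  then show ?thesis
  proof eventually_elim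
    case (elim y)
    then show ?case
      using T(2)[of y] by (auto simp only: mult_minus_left minus_add_distrib[symmetric])
  qed
qed

lemma abs_ess_inf_large_ball_le:
  assumes adm: "admissible \<rho>" and f: "f \<in> BLO M \<rho>" and r: "0 < r" "\<rho> x \<le> r"
  shows "e2ennreal \<bar>ess_inf_on M (ball x r) f\<bar> \<le> ennreal (1 + A1) * BLO_norm M \<rho> f"
proof -
  let ?N = "BLO_norm M \<rho> f" and ?m = "ess_inf_on M (ball x r) f"
  let ?K = "(1 + A1) * enn2real ?N"
  have N: "ennreal (enn2real ?N) = ?N"
    using f by (simp add: BLO_def ennreal_enn2real)
  then have K: "ennreal (1 + A1) * ?N = ennreal ?K"
    using A1_ge_1 by (simp add: ennreal_mult)
  have fm: "f \<in> borel_measurable M"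
    using f by (intro L1_loc_measurable) (simp add: BLO_def)
  have "- ereal ?K \<le> ?m"
  proof (rule ess_inf_on_greatest[OF ball_sets fm])
    show "AE y in M. y \<in> ball x r \<longrightarrow> - ereal ?K \<le> ereal (f y)"
      using BLO_AE_lower_bound[OF adm f]
      by eventually_elim (auto simp only: uminus_ereal.simps ereal_less_eq mult_minus_left)
  qed
  moreover have "e2ennreal ?m \<le> ennreal ?K"
  proof -
    have "e2ennreal ?m \<le> mean_abs M (ball x r) f"
      using ball_measure[OF r(1)] by (intro ess_inf_le_mean_abs[OF ball_sets _ _ fm]) auto
    also have "\<dots> \<le> ?N"
      using r by (rule mean_abs_le_BLO_norm)
    also have "\<dots> \<le> ennreal ?K"
    proof -
      have "1 * enn2real ?N \<le> ?K"
        using A1_ge_1 by (intro mult_right_mono) auto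
      then show ?thesis
        using ennreal_leI N by fastforce
    qed
    finally show ?thesis .
  qed
  ultimately have "e2ennreal \<bar>?m\<bar> \<le> ennreal ?K"
    using A1_ge_1 by (cases ?m) (auto simp: ennreal_le_iff2 top_unique)
  then show ?thesis
    by (simp add: K)
qed

text \<open>The extra summand \<open>\<bar>m\<^sub>B\<bar>\<close> costs \<open>(1 + A1) N\<close> in addition to the norm \<open>N\<close> itself.\<close>

lemma BLO_bounds_ii_of_BLO:
  assumes adm: "admissible \<rho>" and f: "f \<in> BLO M \<rho>"
  shows "(2 + A1) * enn2real (BLO_norm M \<rho> f) \<in> BLO_bounds_ii M \<rho> f"
proof -
  let ?N = "BLO_norm M \<rho> f"
  let ?osc = "SUP (x, r)\<in>balls - large_balls \<rho>. mean_osc M (ball x r) f"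
  let ?abs = "SUP (x, r)\<in>large_balls \<rho>. mean_abs M (ball x r) f"
  have "(SUP (x, r)\<in>large_balls \<rho>. mean_abs M (ball x r) f + e2ennreal \<bar>ess_inf_on M (ball x r) f\<bar>)
      \<le> ?abs + ennreal (1 + A1) * ?N"
  proof (intro SUP_least, clarify)
    fix x r assume xr: "(x, r) \<in> large_balls \<rho>"
    then have "e2ennreal \<bar>ess_inf_on M (ball x r) f\<bar> \<le> ennreal (1 + A1) * ?N"
      by (intro abs_ess_inf_large_ball_le[OF adm f]) (auto simp: large_balls_def balls_def)
    moreover have "mean_abs M (ball x r) f \<le> ?abs"
      using xr by (intro SUP_upper2[of "(x, r)"]) auto
    ultimately show "mean_abs M (ball x r) f + e2ennreal \<bar>ess_inf_on M (ball x r) f\<bar>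
        \<le> ?abs + ennreal (1 + A1) * ?N"
      by (rule add_mono[rotated])
  qed
  then have "?osc + (SUP (x, r)\<in>large_balls \<rho>. mean_abs M (ball x r) f + e2ennreal \<bar>ess_inf_on M (ball x r) f\<bar>)
      \<le> ?osc + (?abs + ennreal (1 + A1) * ?N)"
    by (rule add_left_mono)
  also have "\<dots> = ?N + ennreal (1 + A1) * ?N"
    by (simp only: BLO_norm_def add.assoc)
  also have "\<dots> = ennreal ((2 + A1) * enn2real ?N)"
  proof -
    have "?N + ennreal (1 + A1) * ?N = ennreal (enn2real ?N) + ennreal (1 + A1) * ennreal (enn2real ?N)"
      using f by (simp add: BLO_def ennreal_enn2real)
    also have "\<dots> = ennreal (enn2real ?N + (1 + A1) * enn2real ?N)"
      using A1_ge_1 by (subst ennreal_plus) (auto simp del: ennreal_plus simp: ennreal_mult)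
    finally show ?thesis
      by (simp add: algebra_simps)
  qed
  finally show ?thesis
    using A1_ge_1 by (simp add: BLO_bounds_ii_def)
qed

text \<open>On small balls the oscillation is bounded by \<open>A\<close> directly, on large ones through
  \<open>osc\<^sub>B f \<le> mean\<^sub>B \<bar>f\<bar> + \<bar>m\<^sub>B\<bar> \<le> A\<close>. The means of \<open>\<bar>f\<bar>\<close> over large balls, which are added to the
  oscillations, contribute the second \<open>A\<close>.\<close>

lemma BLO_bounds_iii_of_ii:
  assumes f: "f \<in> L1_loc M" and A: "A \<in> BLO_bounds_ii M \<rho> f"
  shows "2 * A \<in> BLO_bounds_iii M \<rho> f"
proof -
  let ?osc = "SUP (x, r)\<in>balls - large_balls \<rho>. mean_osc M (ball x r) f"
  let ?abs_inf = "SUP (x, r)\<in>large_balls \<rho>. mean_abs M (ball x r) f + e2ennreal \<bar>ess_inf_on M (ball x r) f\<bar>"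
  have A0: "0 \<le> A" and sum: "?osc + ?abs_inf \<le> ennreal A"
    using A by (auto simp: BLO_bounds_ii_def)
  have osc: "?osc \<le> ennreal A"
    by (rule order_trans[OF add_increasing2[OF zero_le order_refl] sum])
  have abs_inf: "?abs_inf \<le> ennreal A"
    by (rule order_trans[OF add_increasing[OF zero_le order_refl] sum])
  have large: "mean_abs M (ball x r) f + e2ennreal \<bar>ess_inf_on M (ball x r) f\<bar> \<le> ennreal A"
    if "(x, r) \<in> large_balls \<rho>" for x r
  proof (rule order_trans[OF _ abs_inf])
    show "mean_abs M (ball x r) f + e2ennreal \<bar>ess_inf_on M (ball x r) f\<bar> \<le> ?abs_inf"
      by (rule SUP_upper2[OF that]) simp
  qed
  have "(SUP (x, r)\<in>balls. mean_osc M (ball x r) f) \<le> ennreal A"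
  proof (rule SUP_least, clarify)
    fix x r assume xr: "(x, r) \<in> (balls :: ('a \<times> real) set)"
    show "mean_osc M (ball x r) f \<le> ennreal A"
    proof (cases "(x, r) \<in> large_balls \<rho>")
      case True
      have "mean_osc M (ball x r) f \<le> mean_abs M (ball x r) f + e2ennreal \<bar>ess_inf_on M (ball x r) f\<bar>"
        using xr ball_measure[of r x]
        by (intro mean_osc_le_mean_abs_plus[OF ball_sets _ _ L1_loc_measurable[OF f]]) (auto simp: balls_def)
      then show ?thesis
        using large[OF True] by (rule order_trans)
    next
      case False
      then have "(x, r) \<in> balls - large_balls \<rho>"
        using xr by blast
      then have "mean_osc M (ball x r) f \<le> ?osc"
        by (rule SUP_upper2) simp
      then show ?thesis
        using osc by (rule order_trans)
    qed
  qed
  moreover have "(SUP (x, r)\<in>large_balls \<rho>. mean_abs M (ball x r) f) \<le> ennreal A"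
  proof (rule SUP_least, clarify)
    fix x r assume "(x, r) \<in> large_balls \<rho>"
    then show "mean_abs M (ball x r) f \<le> ennreal A"
      by (rule order_trans[OF add_increasing2[OF zero_le order_refl] large])
  qed
  ultimately have "(SUP (x, r)\<in>balls. mean_osc M (ball x r) f)
      + (SUP (x, r)\<in>large_balls \<rho>. mean_abs M (ball x r) f) \<le> ennreal A + ennreal A"
    by (rule add_mono)
  also have "\<dots> = ennreal (2 * A)"
    using A0 by (simp flip: ennreal_plus)
  finally show ?thesis
    using A0 by (simp add: BLO_bounds_iii_def)
qed

end

section \<open>Equivalence of the three conditions\<close>

lemma BLO_norm_le_of_bounds_ii:
  assumes "A \<in> BLO_bounds_ii M \<rho> f"
  shows "BLO_norm M \<rho> f \<le> ennreal A"
proof -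
  have "(SUP (x, r)\<in>large_balls \<rho>. mean_abs M (ball x r) f) \<le>
      (SUP (x, r)\<in>large_balls \<rho>. mean_abs M (ball x r) f + e2ennreal \<bar>ess_inf_on M (ball x r) f\<bar>)"
    (is "_ \<le> ?abs_inf")
  proof (rule SUP_least, clarify)
    fix x r assume "(x, r) \<in> large_balls \<rho>"
    then have "mean_abs M (ball x r) f + e2ennreal \<bar>ess_inf_on M (ball x r) f\<bar> \<le> ?abs_inf"
      by (rule SUP_upper2) simp
    then show "mean_abs M (ball x r) f \<le> ?abs_inf"
      by (rule order_trans[OF add_increasing2[OF zero_le order_refl]])
  qed
  then have "BLO_norm M \<rho> f \<le> (SUP (x, r)\<in>balls - large_balls \<rho>. mean_osc M (ball x r) f) + ?abs_inf"
    unfolding BLO_norm_def by (rule add_left_mono)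
  also have "\<dots> \<le> ennreal A"
    using assms by (simp only: BLO_bounds_ii_def mem_Collect_eq)
  finally show ?thesis .
qed

lemma BLO_norm_le_of_bounds_iii:
  assumes "C \<in> BLO_bounds_iii M \<rho> f"
  shows "BLO_norm M \<rho> f \<le> ennreal C"
proof -
  have "BLO_norm M \<rho> f \<le> (SUP (x, r)\<in>balls. mean_osc M (ball x r) f) +
     (SUP (x, r)\<in>large_balls \<rho>. mean_abs M (ball x r) f)"
    unfolding BLO_norm_def by (rule add_right_mono, rule SUP_subset_mono) simp_all
  also have "\<dots> \<le> ennreal C"
    using assms by (simp only: BLO_bounds_iii_def mem_Collect_eq)
  finally show ?thesis .
qed

lemma Inf_bounds_equivalent:
  fixes S :: "real set"
  assumes N: "0 \<le> N" and mem: "L * N \<in> S" and le: "\<And>A. A \<in> S \<Longrightarrow> N \<le> A" and LK: "L \<le> K"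
  shows "N \<le> Inf S \<and> Inf S \<le> K * N"
proof
  show "N \<le> Inf S"
    using mem le by (intro cInf_greatest) auto
  have "Inf S \<le> L * N"
    using mem le by (intro cInf_lower bdd_belowI[of _ N]) auto
  also have "\<dots> \<le> K * N"
    using N LK by (rule mult_right_mono[rotated])
  finally show "Inf S \<le> K * N" .
qed

lemma rd_space_doubling_measure:
  assumes "rd_space (M :: 'a::metric_space measure)"
  shows "\<exists>A1. doubling_measure M A1"
proof -
  have borel: "sets (borel :: 'a measure) \<subseteq> sets M"
    and ball: "\<forall>x r. 0 < r \<longrightarrow> 0 < emeasure M (ball x r) \<and> emeasure M (ball x r) < \<infinity>"
    and dbl: "\<exists>A1\<ge>1. \<forall>x r. 0 < r \<longrightarrow> measure M (ball x (2 * r)) \<le> A1 * measure M (ball x r)"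
    using assms unfolding rd_space_def regular_borel_measure_def by blast+
  have "ball x r \<in> sets M" for x r
    using borel by (rule subsetD) simp
  then show ?thesis
    using ball dbl unfolding doubling_measure_def by blast
qed

theorem theorem3p2:
  fixes M :: "'a::metric_space measure" and \<rho> :: "'a \<Rightarrow> real"
  assumes "rd_space M" and "admissible \<rho>"
  shows "(\<exists>C>0. \<forall>f\<in>BLO M \<rho>. AE x in M. f x \<ge> - C * enn2real (BLO_norm M \<rho> f)) \<and>
    (\<forall>f. (f \<in> BLO M \<rho> \<longleftrightarrow> f \<in> L1_loc M \<and> (\<exists>A. A \<in> BLO_bounds_ii M \<rho> f)) \<and>
         (f \<in> BLO M \<rho> \<longleftrightarrow> f \<in> L1_loc M \<and> (\<exists>C. C \<in> BLO_bounds_iii M \<rho> f))) \<and>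
    (\<exists>K>0. \<forall>f\<in>BLO M \<rho>.
       let N = enn2real (BLO_norm M \<rho> f);
           I2 = Inf (BLO_bounds_ii M \<rho> f);
           I3 = Inf (BLO_bounds_iii M \<rho> f)
       in N \<le> K * I2 \<and> I2 \<le> K * N \<and> N \<le> K * I3 \<and> I3 \<le> K * N \<and> I2 \<le> K * I3 \<and> I3 \<le> K * I2)"
proof -
  obtain A1 where "doubling_measure M A1"
    using rd_space_doubling_measure[OF assms(1)] by blast
  then interpret doubling_measure M A1 .
  note adm = \<open>admissible \<rho>\<close>
  have ii: "(2 + A1) * enn2real (BLO_norm M \<rho> f) \<in> BLO_bounds_ii M \<rho> f" if "f \<in> BLO M \<rho>" for f
    by (rule BLO_bounds_ii_of_BLO[OF adm that])
  have iii: "2 * (2 + A1) * enn2real (BLO_norm M \<rho> f) \<in> BLO_bounds_iii M \<rho> f" if "f \<in> BLO M \<rho>" for f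
    using BLO_bounds_iii_of_ii[OF _ ii[OF that]] that by (simp only: BLO_def mult.assoc mem_Collect_eq)
  have BLO_if_ii: "f \<in> BLO M \<rho>" if "f \<in> L1_loc M" "A \<in> BLO_bounds_ii M \<rho> f" for f A
    using that(1) le_less_trans[OF BLO_norm_le_of_bounds_ii[OF that(2)] ennreal_less_top]
    by (simp add: BLO_def)
  have BLO_if_iii: "f \<in> BLO M \<rho>" if "f \<in> L1_loc M" "A \<in> BLO_bounds_iii M \<rho> f" for f A
    using that(1) le_less_trans[OF BLO_norm_le_of_bounds_iii[OF that(2)] ennreal_less_top]
    by (simp add: BLO_def)
  have L1: "f \<in> L1_loc M" if "f \<in> BLO M \<rho>" for f
    using that by (simp add: BLO_def)
  let ?K = "2 * (2 + A1)"
  have comparable: "let N = enn2real (BLO_norm M \<rho> f); I2 = Inf (BLO_bounds_ii M \<rho> f);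
      I3 = Inf (BLO_bounds_iii M \<rho> f)
    in N \<le> ?K * I2 \<and> I2 \<le> ?K * N \<and> N \<le> ?K * I3 \<and> I3 \<le> ?K * N \<and> I2 \<le> ?K * I3 \<and> I3 \<le> ?K * I2"
    if f: "f \<in> BLO M \<rho>" for f
  proof -
    let ?N = "enn2real (BLO_norm M \<rho> f)"
    have I2: "?N \<le> Inf (BLO_bounds_ii M \<rho> f) \<and> Inf (BLO_bounds_ii M \<rho> f) \<le> ?K * ?N"
    proof (rule Inf_bounds_equivalent[OF enn2real_nonneg ii[OF f]])
      fix A assume A: "A \<in> BLO_bounds_ii M \<rho> f"
      then show "?N \<le> A"
        using BLO_norm_le_of_bounds_ii[OF A] by (intro enn2real_leI) (auto simp: BLO_bounds_ii_def)
    qed (use A1_ge_1 in simp)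
    have I3: "?N \<le> Inf (BLO_bounds_iii M \<rho> f) \<and> Inf (BLO_bounds_iii M \<rho> f) \<le> ?K * ?N"
    proof (rule Inf_bounds_equivalent[OF enn2real_nonneg iii[OF f]])
      fix A assume A: "A \<in> BLO_bounds_iii M \<rho> f"
      then show "?N \<le> A"
        using BLO_norm_le_of_bounds_iii[OF A] by (intro enn2real_leI) (auto simp: BLO_bounds_iii_def)
    qed simp
    \<comment> \<open>Since \<open>?K \<ge> 1\<close>, an infimum above \<open>?N\<close> may be compared, with factor \<open>?K\<close>, both to \<open>?N\<close> and to
      the other infimum, which is at most \<open>?K * ?N\<close>.\<close>
    have N_le: "?N \<le> ?K * I" "?K * ?N \<le> ?K * I" if "?N \<le> I" for I
    proof -
      show "?K * ?N \<le> ?K * I"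
        using that A1_ge_1 by (intro mult_left_mono) auto
      moreover have "1 * ?N \<le> ?K * ?N"
        using A1_ge_1 by (intro mult_right_mono) auto
      ultimately show "?N \<le> ?K * I"
        by simp
    qed
    show ?thesis
      unfolding Let_def
      using I2 I3 N_le[OF conjunct1[OF I2]] N_le[OF conjunct1[OF I3]] by linarith
  qed
  show ?thesis
  proof (intro conjI allI)
    show "\<exists>C>0. \<forall>f\<in>BLO M \<rho>. AE x in M. f x \<ge> - C * enn2real (BLO_norm M \<rho> f)"
      using A1_ge_1 BLO_AE_lower_bound[OF adm] by (intro exI[of _ "1 + A1"]) auto
    show "f \<in> BLO M \<rho> \<longleftrightarrow> f \<in> L1_loc M \<and> (\<exists>A. A \<in> BLO_bounds_ii M \<rho> f)" for f
      using ii L1 BLO_if_ii by blast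
    show "f \<in> BLO M \<rho> \<longleftrightarrow> f \<in> L1_loc M \<and> (\<exists>C. C \<in> BLO_bounds_iii M \<rho> f)" for f
      using iii L1 BLO_if_iii by blast
    show "\<exists>K>0. \<forall>f\<in>BLO M \<rho>.
       let N = enn2real (BLO_norm M \<rho> f);
           I2 = Inf (BLO_bounds_ii M \<rho> f);
           I3 = Inf (BLO_bounds_iii M \<rho> f)
       in N \<le> K * I2 \<and> I2 \<le> K * N \<and> N \<le> K * I3 \<and> I3 \<le> K * N \<and> I2 \<le> K * I3 \<and> I3 \<le> K * I2"
    proof (intro exI[of _ ?K] conjI ballI)
      show "0 < ?K" using A1_ge_1 by simp
    qed (rule comparable)
  qed
qed

end
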